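(* The matrix $\frac13(J_4-I_4)$ is the unique matrix for which the determinant of the matrices from $Z_4$ attains its minimal value.
   Context: $I_4$ is the $4\times4$ identity matrix and $J_4$ is the $4\times4$ matrix all of whose entries equal $1$. A real square matrix is doubly stochastic if all its entries are non-negative and the entries in every row and in every column sum to $1$. $Z_4$ denotes the set of all $4\times4$ symmetric doubly stochastic matrices with vanishing diagonal. *)

theory Defs
  imports "HOL-Analysis.Analysis"
begin

definition doubly_stochastic :: "real ^ 'n ^ 'n \<Rightarrow> bool" where
  "doubly_stochastic A \<longleftrightarrow>
     (\<forall>i j. 0 \<le> A $ i $ j) \<and>
     (\<forall>i. (\<Sum>j\<in>UNIV. A $ i $ j) = 1) \<and>
     (\<forall>j. (\<Sum>i\<in>UNIV. A $ i $ j) = 1)"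

definition Z4 :: "(real ^ 4 ^ 4) set" where
  "Z4 = {A. doubly_stochastic A \<and> transpose A = A \<and> (\<forall>i. A $ i $ i = 0)}"

definition J4 :: "real ^ 4 ^ 4" where
  "J4 = (\<chi> i j. 1)"

text \<open>The identity matrix is \<^term>\<open>mat 1\<close>; the constant \<open>1\<close> on matrices is the
  componentwise one, i.e. the all-ones matrix.\<close>

definition I4 :: "real ^ 4 ^ 4" where
  "I4 = mat 1"

end

theory Submission
  imports Defs
begin

text \<open>Symmetry, the zero diagonal and the row sums force
  \<open>A\<^sub>1\<^sub>2 = A\<^sub>3\<^sub>4 = a\<close>, \<open>A\<^sub>1\<^sub>3 = A\<^sub>2\<^sub>4 = b\<close>, \<open>A\<^sub>1\<^sub>4 = A\<^sub>2\<^sub>3 = c\<close> with \<open>a + b + c = 1\<close>.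
  The columns of a Hadamard matrix are eigenvectors of \<open>A\<close>, with eigenvalues
  \<open>1\<close>, \<open>2a - 1\<close>, \<open>2b - 1\<close>, \<open>2c - 1\<close>. Hence \<open>det A = - x y z\<close>, where \<open>x = 1 - 2a\<close>, \<open>y = 1 - 2b\<close>,
  \<open>z = 1 - 2c\<close> are at most \<open>1\<close> and add up to \<open>1\<close>, so that at most one of them is negative
  and the claim is the inequality of arithmetic and geometric means.\<close>

lemma Z4_entries:
  assumes "A \<in> Z4"
  obtains a b c where "0 \<le> a" "0 \<le> b" "0 \<le> c" "a + b + c = 1"
    "A$1$1 = 0" "A$1$2 = a" "A$1$3 = b" "A$1$4 = c"
    "A$2$1 = a" "A$2$2 = 0" "A$2$3 = c" "A$2$4 = b"
    "A$3$1 = b" "A$3$2 = c" "A$3$3 = 0" "A$3$4 = a"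
    "A$4$1 = c" "A$4$2 = b" "A$4$3 = a" "A$4$4 = 0"
proof -
  have nonneg: "0 \<le> A$i$j" and rows: "(\<Sum>j\<in>UNIV. A$i$j) = 1" and diag: "A$i$i = 0" for i j
    using assms by (auto simp: Z4_def doubly_stochastic_def)
  have "transpose A = A"
    using assms by (simp add: Z4_def)
  then have sym: "A$i$j = A$j$i" for i j
    by (simp add: transpose_def vec_eq_iff)
  have "A$1$2 + A$1$3 + A$1$4 = 1" "A$1$2 + A$2$3 + A$2$4 = 1"
    "A$1$3 + A$2$3 + A$3$4 = 1" "A$1$4 + A$2$4 + A$3$4 = 1"
    using rows[of 1] rows[of 2] rows[of 3] rows[of 4]
    by (simp_all add: sum_4 diag sym[of 2 1] sym[of 3 1] sym[of 4 1]
        sym[of 3 2] sym[of 4 2] sym[of 4 3])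
  \<comment> \<open>Two row sums minus the other two leave twice the difference of a complementary
    pair, such as \<open>A$1$2\<close> and \<open>A$3$4\<close>.\<close>
  then have "A$3$4 = A$1$2" "A$2$4 = A$1$3" "A$2$3 = A$1$4" "A$1$2 + A$1$3 + A$1$4 = 1"
    by linarith+
  then show thesis
    by (intro that[of "A$1$2" "A$1$3" "A$1$4"] nonneg diag) (simp_all add: sym)
qed

text \<open>This is the character table of the Klein four-group; it is symmetric and its square is
  \<open>4\<close> times the identity.\<close>

definition hadamard4 :: "real ^ 4 ^ 4" where
  "hadamard4 = (\<chi> i j. if i = 1 \<or> j = 1 \<or> i = j then 1 else - 1)"

lemma det_hadamard4_nonzero: "det hadamard4 \<noteq> 0"
proof -
  have "hadamard4 ** ((1 / 4) *\<^sub>R hadamard4) = mat 1"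
    by (simp add: vec_eq_iff forall_4 matrix_matrix_mult_def sum_4 hadamard4_def mat_def)
  then show ?thesis
    using invertible_det_nz invertible_right_inverse by blast
qed

lemma det_klein_pattern:
  fixes A :: "real ^ 4 ^ 4"
  assumes "a + b + c = 1"
    "A$1$1 = 0" "A$1$2 = a" "A$1$3 = b" "A$1$4 = c"
    "A$2$1 = a" "A$2$2 = 0" "A$2$3 = c" "A$2$4 = b"
    "A$3$1 = b" "A$3$2 = c" "A$3$3 = 0" "A$3$4 = a"
    "A$4$1 = c" "A$4$2 = b" "A$4$3 = a" "A$4$4 = 0"
  shows "det A = - ((1 - 2 * a) * (1 - 2 * b) * (1 - 2 * c))"
proof -
  \<comment> \<open>For \<open>i\<close> other than 1, column \<open>i\<close> of
    \<open>hadamard4\<close> has as eigenvalue \<open>A$1$i\<close> minus the other two of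
    \<open>a\<close>, \<open>b\<close>, \<open>c\<close>; as these sum to 1, this is
    \<open>2 * A$1$i - 1\<close>.\<close>
  define D :: "real ^ 4 ^ 4" where
    "D = (\<chi> i j. if i = j then (if i = 1 then 1 else 2 * A$1$i - 1) else 0)"
  have "A ** hadamard4 = hadamard4 ** D"
    using assms
    by (simp add: vec_eq_iff forall_4 matrix_matrix_mult_def sum_4 hadamard4_def D_def)
  then have "det A = det D"
    using det_hadamard4_nonzero by (metis det_mul mult.commute mult_cancel_left)
  also have "\<dots> = (\<Prod>i\<in>UNIV. D$i$i)"
    by (rule det_diagonal) (simp add: D_def)
  also have "\<dots> = D$1$1 * D$2$2 * D$3$3 * D$4$4"
    unfolding UNIV_4 by (simp add: mult.assoc)
  also have "\<dots> = (2 * a - 1) * (2 * b - 1) * (2 * c - 1)"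
    using assms(3-5) by (simp add: D_def)
  also have "\<dots> = - ((1 - 2 * a) * (1 - 2 * b) * (1 - 2 * c))"
    by (simp add: algebra_simps)
  finally show ?thesis .
qed

text \<open>One factor may be negative. With a non-negative \<open>x\<close> held fixed, the product
  is largest at \<open>y = z\<close>, which leaves a cubic in \<open>x\<close>.\<close>

lemma amgm3_sum_one:
  fixes x y z :: real
  assumes "x \<le> 1" "y \<le> 1" "z \<le> 1" "x + y + z = 1"
  shows "x * y * z \<le> 1 / 27"
    and "x * y * z = 1 / 27 \<Longrightarrow> x = 1 / 3 \<and> y = 1 / 3 \<and> z = 1 / 3"
proof -
  have *: "x * y * z \<le> 1 / 27 \<and> (x * y * z = 1 / 27 \<longrightarrow> x = y \<and> y = z)"
    if "0 \<le> x" "x \<le> 1" "y \<le> 1" "z \<le> 1" "x + y + z = 1" for x y z :: real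
  proof -
    have z: "z = 1 - x - y"
      using that by simp
    have yz: "4 * (x * y * z) = x * (1 - x)\<^sup>2 - x * (y - z)\<^sup>2"
      unfolding z by (simp add: power2_eq_square algebra_simps)
    \<comment> \<open>The maximum on the unit interval is at \<open>1 / 3\<close>, hence the double
      root.\<close>
    have x: "4 / 27 - x * (1 - x)\<^sup>2 = (1 / 3 - x)\<^sup>2 * (4 / 3 - x)"
      by (simp add: power2_eq_square algebra_simps)
    have nonneg: "0 \<le> x * (y - z)\<^sup>2" "0 \<le> (1 / 3 - x)\<^sup>2 * (4 / 3 - x)"
      using that by auto
    have "x * y * z \<le> 1 / 27"
      using nonneg yz x by linarith
    moreover have "x = y \<and> y = z" if "x * y * z = 1 / 27"
    proof -
      have "(1 / 3 - x)\<^sup>2 * (4 / 3 - x) = 0" "x * (y - z)\<^sup>2 = 0"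
        using nonneg yz x that by linarith+
      then show ?thesis
        using \<open>x \<le> 1\<close> z by auto
    qed
    ultimately show ?thesis
      by blast
  qed
  \<comment> \<open>Otherwise \<open>z\<close> would exceed 1. If only \<open>y\<close> is
    non-negative, it takes the first place.\<close>
  have "0 \<le> x \<or> 0 \<le> y"
    using assms by linarith
  then have main: "x * y * z \<le> 1 / 27 \<and> (x * y * z = 1 / 27 \<longrightarrow> x = y \<and> y = z)"
    using *[of x y z] *[of y x z] assms by (auto simp: mult.commute)
  then show "x * y * z \<le> 1 / 27"
    by blast
  show "x = 1 / 3 \<and> y = 1 / 3 \<and> z = 1 / 3" if "x * y * z = 1 / 27"
    using main that assms(4) by auto
qed

lemma third_J4_minus_I4_in_Z4: "(1 / 3) *\<^sub>R (J4 - I4) \<in> Z4"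
  by (simp add: Z4_def doubly_stochastic_def J4_def I4_def mat_def transpose_def
      vec_eq_iff forall_4 sum_4)

lemma det_third_J4_minus_I4: "det ((1 / 3) *\<^sub>R (J4 - I4)) = - (1 / 27)"
  by (subst det_klein_pattern[of "1 / 3" "1 / 3" "1 / 3"])
    (simp_all add: J4_def I4_def mat_def)

lemma det_Z4:
  assumes "A \<in> Z4"
  shows "- (1 / 27) \<le> det A"
    and "det A = - (1 / 27) \<Longrightarrow> A = (1 / 3) *\<^sub>R (J4 - I4)"
proof -
  obtain a b c where nonneg: "0 \<le> a" "0 \<le> b" "0 \<le> c" and sum: "a + b + c = 1"
    and entries: "A$1$1 = 0" "A$1$2 = a" "A$1$3 = b" "A$1$4 = c"
    "A$2$1 = a" "A$2$2 = 0" "A$2$3 = c" "A$2$4 = b"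
    "A$3$1 = b" "A$3$2 = c" "A$3$3 = 0" "A$3$4 = a"
    "A$4$1 = c" "A$4$2 = b" "A$4$3 = a" "A$4$4 = 0"
    using Z4_entries[OF assms] .
  have det: "det A = - ((1 - 2 * a) * (1 - 2 * b) * (1 - 2 * c))"
    by (rule det_klein_pattern[OF sum entries])
  have sum': "(1 - 2 * a) + (1 - 2 * b) + (1 - 2 * c) = 1"
    using sum by simp
  note amgm = amgm3_sum_one[OF _ _ _ sum']
  show "- (1 / 27) \<le> det A"
    \<comment> \<open>Non-negative entries make each factor at most 1.\<close>
    using amgm(1) nonneg det by simp
  show "A = (1 / 3) *\<^sub>R (J4 - I4)" if "det A = - (1 / 27)"
  proof -
    have "a = 1 / 3" "b = 1 / 3" "c = 1 / 3"
      using amgm(2) nonneg det that by auto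
    then show ?thesis
      using entries by (simp add: vec_eq_iff forall_4 J4_def I4_def mat_def)
  qed
qed

theorem proposition6p12:
  fixes A :: "real ^ 4 ^ 4"
  shows "is_arg_min det (\<lambda>B. B \<in> Z4) A \<longleftrightarrow> A = (1 / 3) *\<^sub>R (J4 - I4)"
proof
  assume A: "is_arg_min det (\<lambda>B. B \<in> Z4) A"
  then have "A \<in> Z4" "det A \<le> - (1 / 27)"
    using third_J4_minus_I4_in_Z4 det_third_J4_minus_I4
    by (auto simp: is_arg_min_linorder)
  then show "A = (1 / 3) *\<^sub>R (J4 - I4)"
    using det_Z4 by (simp add: order_antisym)
next
  assume "A = (1 / 3) *\<^sub>R (J4 - I4)"
  then show "is_arg_min det (\<lambda>B. B \<in> Z4) A"
    using det_Z4(1) third_J4_minus_I4_in_Z4 det_third_J4_minus_I4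
    by (simp add: is_arg_min_linorder)
qed

end
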